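(* Let $\lambda,\mu,\nu$ be partitions of the same integer with $\ell(\lambda)\le 4$, $\ell(\mu),\ell(\nu)\le 2$, and $\mu_2\ge\nu_2$. Then $\tilde g_{\mu,\nu,\lambda}\ge g_{\mu,\nu,\lambda}$.
   Context: Partitions are padded with zero parts. The Kronecker coefficient $g_{\mu,\nu,\lambda}$ is defined by $s_\lambda(x_1y_1,x_1y_2,x_2y_1,x_2y_2)=\sum_{\mu,\nu}g_{\mu,\nu,\lambda}\,s_\mu(x_1,x_2)s_\nu(y_1,y_2)$, with $s$ the Schur polynomials. For integers $n,m$, $p_S(n,m)$ is the number of $(x_1,\dots,x_4)\in\mathbb{Z}_{\ge0}^4$ with $x_1+x_3+x_4=n$, $x_2+x_3+2x_4=m$ (zero if $n<0$ or $m<0$). The atomic Kronecker coefficient is $\tilde g_{\mu,\nu,\lambda}:=p_S(\nu_2-\lambda_3-\lambda_4,\ \mu_2+\nu_2-\lambda_2-\lambda_3-2\lambda_4)$; equivalently, it is the coefficient of $x^{\mu_2-\lambda_2-\lambda_4}y^{\nu_2-\lambda_3-\lambda_4}$ in the Laurent expansion of $1/((1-y/x)(1-xy)(1-x)(1-y))$ in the domain $0<|xy|<|y|<|x|<1$. *)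

theory Defs
  imports Complex_Main
begin

definition is_partition :: "nat list \<Rightarrow> bool" where
  "is_partition p \<longleftrightarrow> sorted_wrt (\<ge>) p \<and> 0 \<notin> set p"

definition part :: "nat list \<Rightarrow> nat \<Rightarrow> nat" where
  "part p i = (if 1 \<le> i \<and> i \<le> length p then p ! (i - 1) else 0)"

definition partitions_upto :: "nat \<Rightarrow> nat \<Rightarrow> nat list set" where
  "partitions_upto n k = {p. is_partition p \<and> sum_list p = n \<and> length p \<le> k}"

definition cells :: "nat list \<Rightarrow> (nat \<times> nat) set" where
  "cells la = {(i, j). i < length la \<and> j < la ! i}"

definition ssyt :: "nat \<Rightarrow> nat list \<Rightarrow> (nat \<times> nat \<Rightarrow> nat) set" where
  "ssyt N la = {T. (\<forall>c\<in>cells la. T c < N)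
     \<and> (\<forall>c. c \<notin> cells la \<longrightarrow> T c = 0)
     \<and> (\<forall>i j. (i, Suc j) \<in> cells la \<longrightarrow> T (i, j) \<le> T (i, Suc j))
     \<and> (\<forall>i j. (Suc i, j) \<in> cells la \<longrightarrow> T (i, j) < T (Suc i, j))}"

definition schur :: "nat \<Rightarrow> nat list \<Rightarrow> (nat \<Rightarrow> real) \<Rightarrow> real" where
  "schur N la x = (\<Sum>T\<in>ssyt N la. \<Prod>c\<in>cells la. x (T c))"

definition prodvars :: "(nat \<Rightarrow> real) \<Rightarrow> (nat \<Rightarrow> real) \<Rightarrow> nat \<Rightarrow> real" where
  "prodvars x y k = (if k = 0 then x 0 * y 0 else if k = 1 then x 0 * y 1
                     else if k = 2 then x 1 * y 0 else x 1 * y 1)"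

text \<open>Kronecker coefficient: the coefficients in the expansion
  s_la(x_iy_j) = sum_{mu,nu} g s_mu(x_1,x_2) s_nu(y_1,y_2), where mu, nu range over
  partitions with at most two parts (necessarily of size |la| by homogeneity).\<close>
definition kron :: "nat list \<Rightarrow> nat list \<Rightarrow> nat list \<Rightarrow> real" where
  "kron mu nu la =
    (THE c. (\<forall>x y. schur 4 la (prodvars x y) =
              (\<Sum>m\<in>partitions_upto (sum_list la) 2. \<Sum>n\<in>partitions_upto (sum_list la) 2.
                  c m n * schur 2 m x * schur 2 n y))
          \<and> (\<forall>m n. m \<notin> partitions_upto (sum_list la) 2 \<or> n \<notin> partitions_upto (sum_list la) 2
                   \<longrightarrow> c m n = 0)) mu nu"

definition pS :: "int \<Rightarrow> int \<Rightarrow> nat" where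
  "pS n m = (if n < 0 \<or> m < 0 then 0 else
     card {v :: nat \<times> nat \<times> nat \<times> nat. case v of (x1, x2, x3, x4) \<Rightarrow>
             int x1 + int x3 + int x4 = n \<and> int x2 + int x3 + 2 * int x4 = m})"

definition atomic_kron :: "nat list \<Rightarrow> nat list \<Rightarrow> nat list \<Rightarrow> nat" where
  "atomic_kron mu nu la =
     pS (int (part nu 2) - int (part la 3) - int (part la 4))
        (int (part mu 2) + int (part nu 2) - int (part la 2) - int (part la 3) - 2 * int (part la 4))"

end

theory Submission
  imports Defs
begin

text \<open>
  Encode tableaux by Gelfand--Tsetlin patterns and let \<open>F i j\<close> count the patterns of weight
  \<open>x\<^sub>2\<^sup>i y\<^sub>2\<^sup>j\<close>. Since \<open>F\<close> is symmetric under \<open>i \<mapsto> n - i\<close>, under \<open>j \<mapsto> n - j\<close> and under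
  exchanging its arguments, the Kronecker coefficient is the second difference of \<open>F\<close> at
  \<open>(\<mu>\<^sub>2, \<nu>\<^sub>2)\<close>. The symmetry under exchange allows letting the entries 1, 2, 3 carry the weights
  \<open>x, y, x y\<close>. For fixed second row \<open>(b1, b2)\<close> the patterns are then the lattice points of a product
  of four intervals, so by Clebsch--Gordan the first difference in \<open>i\<close>, for \<open>2 i \<le> n\<close>, counts
  patterns satisfying ballot conditions. Raising \<open>b1\<close> lowers \<open>j\<close> by one and preserves these
  conditions as long as \<open>b1 < c1\<close>. The second difference is thus at most the number of ballot
  patterns with \<open>b1 = c1\<close>, and the remaining coordinates of such a pattern form a solution counted by
  \<open>p\<^sub>S\<close>. Representation-theoretically, the irreducible module is a quotient of a Verma module,
  which is free over the lowering operators of \<open>gl\<^sub>2 \<times> gl\<^sub>2\<close>.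
\<close>

subsection \<open>Clebsch--Gordan for lattice points in a box\<close>

text \<open>Convolving with \<open>{0..W}\<close> is tensoring with the \<open>sl\<^sub>2\<close>-module of dimension \<open>W + 1\<close>;
  \<open>d\<close> is the difference of consecutive weight multiplicities, antisymmetric by the Weyl reflection.\<close>

lemma antisym_sum_interval_eq_0:
  fixes d :: "int \<Rightarrow> int"
  assumes "\<And>l. d (s + 1 - l) = - d l"
  shows "(\<Sum>w\<in>{0..2 * k - s - 1}. d (k - w)) = 0"
proof -
  \<comment> \<open>The arguments \<open>k - w\<close> fill the interval from
    \<open>s + 1 - k\<close> to \<open>k\<close>, which the reflection maps onto itself, so the sum
    is its own negative.\<close>
  have "(\<Sum>w\<in>{0..2 * k - s - 1}. d (k - w)) = (\<Sum>w\<in>{0..2 * k - s - 1}. d (s + 1 - (k - w)))"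
    by (rule sum.reindex_bij_witness[of _ "\<lambda>w. 2 * k - s - 1 - w" "\<lambda>w. 2 * k - s - 1 - w"])
       (auto simp: algebra_simps)
  also have "\<dots> = - (\<Sum>w\<in>{0..2 * k - s - 1}. d (k - w))"
    by (simp only: assms sum_negf)
  finally show ?thesis by simp
qed

text \<open>The reflection centre moves by \<open>W / 2\<close>, so antisymmetry survives and the
  next factor can be treated alike.\<close>

lemma antisym_convolve_interval:
  fixes d :: "int \<Rightarrow> int"
  assumes "\<And>l. d (s + 1 - l) = - d l"
  shows "(\<Sum>w\<in>{0..W}. d (s + W + 1 - k - w)) = - (\<Sum>w\<in>{0..W}. d (k - w))"
proof -
  have "(\<Sum>w\<in>{0..W}. d (s + W + 1 - k - w)) = (\<Sum>w\<in>{0..W}. d (s + 1 - (k - w)))"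
    by (rule sum.reindex_bij_witness[of _ "\<lambda>w. W - w" "\<lambda>w. W - w"]) (auto simp: algebra_simps)
  then show ?thesis by (simp only: assms sum_negf)
qed

text \<open>The discarded \<open>w\<close> form the segment \<open>{0..2 * k - s - 1}\<close>, whose
  terms cancel; the bound on \<open>k\<close> keeps it inside \<open>{0..W}\<close>. What remains is
  the Clebsch-Gordan rule.\<close>

lemma convolve_interval_truncate:
  fixes d :: "int \<Rightarrow> int"
  assumes "\<And>l. d (s + 1 - l) = - d l" and "2 * k \<le> s + W"
  shows "(\<Sum>w\<in>{0..W}. d (k - w)) = (\<Sum>w\<in>{w\<in>{0..W}. w \<le> s - 2 * (k - w)}. d (k - w))"
proof -
  have "(\<Sum>w\<in>{0..W}. d (k - w)) =
      (\<Sum>w\<in>{w\<in>{0..W}. w \<le> s - 2 * (k - w)} \<union> {0..2 * k - s - 1}. d (k - w))"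
    using assms(2) by (intro sum.cong) auto
  also have "\<dots> = (\<Sum>w\<in>{w\<in>{0..W}. w \<le> s - 2 * (k - w)}. d (k - w))
      + (\<Sum>w\<in>{0..2 * k - s - 1}. d (k - w))"
    by (rule sum.union_disjoint) (auto simp del: atLeastAtMost_iff, auto)
  finally show ?thesis using antisym_sum_interval_eq_0[of d s k] assms(1) by simp
qed

lemma int_card_filter:
  "finite A \<Longrightarrow> int (card {x\<in>A. P x}) = (\<Sum>x\<in>A. of_bool (P x))"
  by (simp add: Int_def)

lemma int_card_Sigma:
  "finite A \<Longrightarrow> (\<And>x. finite (B x)) \<Longrightarrow> int (card (Sigma A B)) = (\<Sum>x\<in>A. int (card (B x)))"
  by simp

text \<open>Weight vectors \<open>k\<close> steps below the top in a tensor product of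
  \<open>sl_2\<close>-modules of dimensions \<open>M + 1\<close>, \<open>U + 1\<close>,
  \<open>V + 1\<close>, \<open>W + 1\<close>.\<close>

definition box :: "int \<Rightarrow> int \<Rightarrow> int \<Rightarrow> int \<Rightarrow> int \<Rightarrow> (int \<times> int \<times> int \<times> int) set" where
  "box M U V W k = {(t, u, v, w). t \<in> {0..M} \<and> u \<in> {0..U} \<and> v \<in> {0..V} \<and> w \<in> {0..W}
     \<and> t + u + v + w = k}"

text \<open>Highest weight vectors of a fourfold tensor product; the first factor contributes only its
  own highest weight vector, so its coordinate \<open>t = 0\<close> is dropped.\<close>

definition ballot_box :: "int \<Rightarrow> int \<Rightarrow> int \<Rightarrow> int \<Rightarrow> int \<Rightarrow> (int \<times> int \<times> int) set" where
  "ballot_box M U V W k = {(u, v, w). u \<in> {0..U} \<and> v \<in> {0..V} \<and> w \<in> {0..W} \<and> u + v + w = k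
     \<and> u \<le> M \<and> v \<le> M + U - 2 * u \<and> w \<le> M + U + V - 2 * u - 2 * v}"

lemma finite_box: "finite (box M U V W k)"
  by (rule finite_subset[of _ "{0..M} \<times> {0..U} \<times> {0..V} \<times> {0..W}"]) (auto simp: box_def)

lemma finite_ballot_box: "finite (ballot_box M U V W k)"
  by (rule finite_subset[of _ "{0..U} \<times> {0..V} \<times> {0..W}"]) (auto simp: ballot_box_def)

lemma card_box:
  "int (card (box M U V W k)) = (\<Sum>w\<in>{0..W}. \<Sum>v\<in>{0..V}. \<Sum>u\<in>{0..U}. of_bool (k - w - v - u \<in> {0..M}))"
proof -
  let ?S = "SIGMA w:{0..W}. SIGMA v:{0..V}. {u\<in>{0..U}. k - w - v - u \<in> {0..M}}"
  have fin: "finite {x\<in>{0..n :: int}. P x}" for n P by (simp del: atLeastAtMost_iff)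
  have "card (box M U V W k) = card ?S"
    by (rule bij_betw_same_card[OF bij_betw_byWitness[of _ "\<lambda>(w, v, u). (k - w - v - u, u, v, w)"
        "\<lambda>(t, u, v, w). (w, v, u)"]]) (auto simp: box_def)
  moreover have "int (card ?S) = (\<Sum>w\<in>{0..W}. \<Sum>v\<in>{0..V}. \<Sum>u\<in>{0..U}. of_bool (k - w - v - u \<in> {0..M}))"
    by (simp only: int_card_Sigma int_card_filter finite_SigmaI fin finite_atLeastAtMost_int)
  ultimately show ?thesis by (simp only:)
qed

lemma card_ballot_box:
  "int (card (ballot_box M U V W k)) =
    (\<Sum>w\<in>{w\<in>{0..W}. w \<le> M + U + V - 2 * (k - w)}. \<Sum>v\<in>{v\<in>{0..V}. v \<le> M + U - 2 * (k - w - v)}.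
      \<Sum>u\<in>{u\<in>{0..U}. u \<le> M - 2 * (k - w - v - u)}. of_bool (k - w - v - u = 0))"
proof -
  let ?S = "SIGMA w:{w\<in>{0..W}. w \<le> M + U + V - 2 * (k - w)}. SIGMA v:{v\<in>{0..V}. v \<le> M + U - 2 * (k - w - v)}.
      {u\<in>{u\<in>{0..U}. u \<le> M - 2 * (k - w - v - u)}. k - w - v - u = 0}"
  have fin: "finite {x\<in>{0..n :: int}. P x}" for n P by (simp del: atLeastAtMost_iff)
  have "card (ballot_box M U V W k) = card ?S"
    by (rule bij_betw_same_card[OF bij_betw_byWitness[of _ "\<lambda>(w, v, u). (u, v, w)"
        "\<lambda>(u, v, w). (w, v, u)"]]) (auto simp: ballot_box_def)
  moreover have "int (card ?S) = (\<Sum>w\<in>{w\<in>{0..W}. w \<le> M + U + V - 2 * (k - w)}. \<Sum>v\<in>{v\<in>{0..V}. v \<le> M + U - 2 * (k - w - v)}.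
      \<Sum>u\<in>{u\<in>{0..U}. u \<le> M - 2 * (k - w - v - u)}. of_bool (k - w - v - u = 0))"
    unfolding int_card_Sigma[OF fin finite_SigmaI[OF fin finite_subset[OF _ fin]], OF Collect_restrict]
      int_card_Sigma[OF fin finite_subset[OF _ fin], OF Collect_restrict] int_card_filter[OF fin] ..
  ultimately show ?thesis by (simp only:)
qed

lemma card_box_diff:
  assumes "0 \<le> M" and k: "2 * k \<le> M + U + V + W"
  shows "int (card (box M U V W k)) - int (card (box M U V W (k - 1))) = int (card (ballot_box M U V W k))"
proof -
  define d1 :: "int \<Rightarrow> int" where "d1 l = of_bool (l = 0) - of_bool (l = M + 1)" for l
  define d2 where "d2 l = (\<Sum>u\<in>{0..U}. d1 (l - u))" for l
  define d3 where "d3 l = (\<Sum>v\<in>{0..V}. d2 (l - v))" for l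
  have d1: "d1 (M + 1 - l) = - d1 l" for l by (auto simp: d1_def)
  have d2: "d2 (M + U + 1 - l) = - d2 l" for l
    unfolding d2_def by (rule antisym_convolve_interval) (rule d1)
  have d3: "d3 (M + U + V + 1 - l) = - d3 l" for l
    unfolding d3_def by (rule antisym_convolve_interval) (rule d2)
  have "of_bool (l \<in> {0..M}) - of_bool (l - 1 \<in> {0..M}) = d1 l" for l
    using \<open>0 \<le> M\<close> by (auto simp: d1_def)
  then have 1: "of_bool (k - w - v - u \<in> {0..M}) - of_bool (k - 1 - w - v - u \<in> {0..M}) = d1 (k - w - v - u)" for w v u
    by (metis (no_types, lifting) diff_diff_eq diff_right_commute)
  have "int (card (box M U V W k)) - int (card (box M U V W (k - 1))) = (\<Sum>w\<in>{0..W}. d3 (k - w))"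
    unfolding card_box d3_def d2_def sum_subtractf[symmetric] 1 ..
  also have "\<dots> = (\<Sum>w\<in>{w\<in>{0..W}. w \<le> M + U + V - 2 * (k - w)}. d3 (k - w))"
    using k by (intro convolve_interval_truncate[where d = d3, OF d3])
  \<comment> \<open>The truncation of \<open>w\<close> just made, with \<open>0 \<le> w\<close>, is
    the hypothesis for truncating \<open>v\<close>; the one of \<open>v\<close> then serves for
    \<open>u\<close>.\<close>
  also have "\<dots> = (\<Sum>w\<in>{w\<in>{0..W}. w \<le> M + U + V - 2 * (k - w)}. \<Sum>v\<in>{v\<in>{0..V}. v \<le> M + U - 2 * (k - w - v)}.
      d2 (k - w - v))"
    unfolding d3_def by (rule sum.cong[OF refl], rule convolve_interval_truncate[where d = d2, OF d2]) simp
  also have "\<dots> = (\<Sum>w\<in>{w\<in>{0..W}. w \<le> M + U + V - 2 * (k - w)}. \<Sum>v\<in>{v\<in>{0..V}. v \<le> M + U - 2 * (k - w - v)}.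
      \<Sum>u\<in>{u\<in>{0..U}. u \<le> M - 2 * (k - w - v - u)}. d1 (k - w - v - u))"
    unfolding d2_def
    by (rule sum.cong[OF refl], rule sum.cong[OF refl], rule convolve_interval_truncate[where d = d1, OF d1]) simp
  \<comment> \<open>At \<open>l = M + 1\<close> the bound on \<open>u\<close> is negative, so only
    the part of \<open>d1 l\<close> at \<open>l = 0\<close> survives.\<close>
  also have "\<dots> = int (card (ballot_box M U V W k))"
    unfolding card_ballot_box using \<open>0 \<le> M\<close> by (intro sum.cong refl) (auto simp: d1_def)
  finally show ?thesis .
qed

subsection \<open>Patterns with four rows\<close>

locale four_parts =
  fixes l1 l2 l3 l4 :: int
  assumes parts_decreasing: "l2 \<le> l1" "l3 \<le> l2" "l4 \<le> l3" "0 \<le> l4"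
begin

definition total :: int where "total = l1 + l2 + l3 + l4"

definition patterns :: "(int \<times> int \<times> int \<times> int \<times> int \<times> int) set" where
  "patterns = {(a, b1, b2, c1, c2, c3). b2 \<le> a \<and> a \<le> b1 \<and> c2 \<le> b1 \<and> b1 \<le> c1 \<and> c3 \<le> b2 \<and> b2 \<le> c2
     \<and> l2 \<le> c1 \<and> c1 \<le> l1 \<and> l3 \<le> c2 \<and> c2 \<le> l2 \<and> l4 \<le> c3 \<and> c3 \<le> l3}"

text \<open>The rows \<open>(a)\<close>, \<open>(b1, b2)\<close>, \<open>(c1, c2, c3)\<close>, \<open>(l1, l2, l3, l4)\<close> are the shapes formed by the entries
  below \<open>1, 2, 3, 4\<close>. Hence \<open>i\<close> is the number of entries \<open>2\<close> and \<open>3\<close>, and \<open>j\<close> that of entries \<open>1\<close> and \<open>3\<close>.\<close>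

definition weight_count :: "int \<Rightarrow> int \<Rightarrow> nat" where
  "weight_count i j = card {(a, b1, b2, c1, c2, c3) \<in> patterns.
     total - b1 - b2 = i \<and> (b1 + b2 - a) + (total - c1 - c2 - c3) = j}"

lemma finite_patterns: "finite patterns"
  by (rule finite_subset[of _ "{l4..l1} \<times> {l4..l1} \<times> {l4..l1} \<times> {l4..l1} \<times> {l4..l1} \<times> {l4..l1}"])
     (use parts_decreasing in \<open>auto simp: patterns_def\<close>)

lemma pattern_weight_bounds:
  assumes "(a, b1, b2, c1, c2, c3) \<in> patterns"
  shows "0 \<le> total - b1 - b2" "total - b1 - b2 \<le> total"
    "0 \<le> (b1 + b2 - a) + (total - c1 - c2 - c3)" "(b1 + b2 - a) + (total - c1 - c2 - c3) \<le> total"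
  using assms parts_decreasing by (auto simp: patterns_def total_def)

lemma weight_count_eq_0: "i < 0 \<or> j < 0 \<Longrightarrow> weight_count i j = 0"
  unfolding weight_count_def using pattern_weight_bounds by (intro card_eq_0_iff[THEN iffD2]) fastforce

text \<open>Each row can be reflected in the intervals that its two neighbouring rows allow; this exchanges
  the multiplicities of two consecutive entries.\<close>

lemma weight_count_swap: "weight_count i j = weight_count j i"
proof -
  let ?f = "\<lambda>(a, b1, b2, c1, c2, c3). (a :: int, c1 + max a c2 - b1, c3 + min a c2 - b2, c1 :: int, c2, c3 :: int)"
  show ?thesis unfolding weight_count_def
    by (rule bij_betw_same_card[OF bij_betw_byWitness[of _ ?f ?f]])
       (auto simp: patterns_def max_def min_def)
qed

lemma weight_count_reflect: "weight_count i (total - j) = weight_count i j"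
proof -
  \<comment> \<open>Reflecting the rows of lengths 1 and 3 exchanges entries 0 with 1 and 2 with 3;
    this fixes \<open>i\<close> and complements \<open>j\<close>.\<close>
  let ?f = "\<lambda>(a, b1, b2, c1, c2, c3). (b1 + b2 - a, b1, b2, l1 + max b1 l2 - c1,
      min b1 l2 + max b2 l3 - c2, min b2 l3 + l4 - c3)"
  show ?thesis unfolding weight_count_def
    by (rule bij_betw_same_card[OF bij_betw_byWitness[of _ ?f ?f]])
       (auto simp: patterns_def max_def min_def total_def)
qed

text \<open>The last three conditions are the ballot conditions of the tensor product below, expressed in
  pattern coordinates. Only the first involves \<open>b1\<close>, and increasing \<open>b1\<close> preserves it: this
  monotonicity is what bounds the second difference.\<close>

definition highest_patterns :: "int \<Rightarrow> int \<Rightarrow> (int \<times> int \<times> int \<times> int \<times> int) set" where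
  "highest_patterns i j = {(b1, b2, c1, c2, c3). (b1, b1, b2, c1, c2, c3) \<in> patterns
     \<and> total - b1 - b2 = j \<and> b2 + total - c1 - c2 - c3 = i
     \<and> l1 - c1 \<le> b1 - b2 \<and> l1 + l2 + b2 \<le> c2 + 2 * c1 \<and> l1 + l2 + l3 + 2 * b2 \<le> c3 + 2 * c1 + 2 * c2}"

text \<open>Apart from the weight condition, this says exactly that the four interval lengths in
  \<open>row_box\<close> are nonnegative.\<close>

definition middle_rows :: "int \<Rightarrow> (int \<times> int) set" where
  "middle_rows j = {(b1, b2). b2 \<le> b1 \<and> b1 \<le> l1 \<and> l3 \<le> b1 \<and> b2 \<le> l2 \<and> l4 \<le> b2 \<and> total - b1 - b2 = j}"

lemma finite_middle_rows: "finite (middle_rows j)"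
  by (rule finite_subset[of _ "{l4..l1} \<times> {l4..l1}"])
     (use parts_decreasing in \<open>auto simp: middle_rows_def\<close>)

text \<open>For fixed \<open>(b1, b2)\<close> the remaining entries of a pattern range over independent intervals.
  The coordinates are \<open>t = b1 - a\<close>, \<open>u = l1 - c1\<close>, \<open>v = min b1 l2 - c2\<close>, \<open>w = min b2 l3 - c3\<close>.\<close>

definition row_box :: "int \<Rightarrow> int \<Rightarrow> int \<Rightarrow> (int \<times> int \<times> int \<times> int) set" where
  "row_box b1 b2 i = box (b1 - b2) (l1 - max b1 l2) (min b1 l2 - max b2 l3) (min b2 l3 - l4)
     (i - b2 - total + l1 + min b1 l2 + min b2 l3)"

definition row_ballot_box :: "int \<Rightarrow> int \<Rightarrow> int \<Rightarrow> (int \<times> int \<times> int) set" where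
  "row_ballot_box b1 b2 i = ballot_box (b1 - b2) (l1 - max b1 l2) (min b1 l2 - max b2 l3) (min b2 l3 - l4)
     (i - b2 - total + l1 + min b1 l2 + min b2 l3)"

text \<open>The first weight depends on \<open>(b1, b2)\<close> alone; the second one becomes the
  level in the box over that row.\<close>

lemma weight_count_eq_sum:
  "int (weight_count j i) = (\<Sum>(b1, b2)\<in>middle_rows j. int (card (row_box b1 b2 i)))"
proof -
  let ?S = "SIGMA b:middle_rows j. (case b of (b1, b2) \<Rightarrow> row_box b1 b2 i)"
  have "weight_count j i = card ?S"
    unfolding weight_count_def
    by (rule bij_betw_same_card[OF bij_betw_byWitness[of _
        "\<lambda>((b1, b2), t, u, v, w). (b1 - t, b1, b2, l1 - u, min b1 l2 - v, min b2 l3 - w)"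
        "\<lambda>(a, b1, b2, c1, c2, c3). ((b1, b2), b1 - a, l1 - c1, min b1 l2 - c2, min b2 l3 - c3)"]])
       (auto simp: patterns_def middle_rows_def row_box_def box_def total_def min_def max_def
         split: if_splits)
  then show ?thesis
    by (simp add: finite_middle_rows row_box_def finite_box case_prod_beta)
qed

text \<open>Since \<open>min b1 l2 + max b1 l2 = b1 + l2\<close>, and likewise for \<open>b2\<close>
  and \<open>l3\<close>, the ballot conditions become linear and \<open>b1\<close> cancels from all
  but the first.\<close>

lemma card_highest_patterns_eq_sum:
  "int (card (highest_patterns i j)) = (\<Sum>(b1, b2)\<in>middle_rows j. int (card (row_ballot_box b1 b2 i)))"
proof -
  let ?S = "SIGMA b:middle_rows j. (case b of (b1, b2) \<Rightarrow> row_ballot_box b1 b2 i)"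
  have "card (highest_patterns i j) = card ?S"
    by (rule bij_betw_same_card[OF bij_betw_byWitness[of _
        "\<lambda>((b1, b2), u, v, w). (b1, b2, l1 - u, min b1 l2 - v, min b2 l3 - w)"
        "\<lambda>(b1, b2, c1, c2, c3). ((b1, b2), l1 - c1, min b1 l2 - c2, min b2 l3 - c3)"]])
       (auto simp: highest_patterns_def patterns_def middle_rows_def row_ballot_box_def ballot_box_def
         total_def min_def max_def split: if_splits)
  then show ?thesis
    by (simp add: finite_middle_rows row_ballot_box_def finite_ballot_box case_prod_beta)
qed

text \<open>In every box the sum of the interval lengths minus twice the level equals
  \<open>total - 2 * i\<close>, so one inequality serves all middle rows.\<close>

lemma weight_count_diff:
  assumes "2 * i \<le> total"
  shows "int (weight_count j i) - int (weight_count j (i - 1)) = int (card (highest_patterns i j))"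
proof -
  have "int (card (row_box b1 b2 i)) - int (card (row_box b1 b2 (i - 1))) = int (card (row_ballot_box b1 b2 i))"
    if "(b1, b2) \<in> middle_rows j" for b1 b2
  proof -
    have *: "i - 1 - b2 - total + l1 + min b1 l2 + min b2 l3 = (i - b2 - total + l1 + min b1 l2 + min b2 l3) - 1"
      by simp
    show ?thesis
      unfolding row_box_def row_ballot_box_def *
      by (rule card_box_diff)
         (use that assms in \<open>auto simp: middle_rows_def total_def min_def max_def\<close>)
  qed
  then show ?thesis
    unfolding weight_count_eq_sum card_highest_patterns_eq_sum sum_subtractf[symmetric]
    by (intro sum.cong) auto
qed

section \<open>Bounding the second difference by the solutions counted by \<open>pS\<close>\<close>

lemma finite_highest_patterns: "finite (highest_patterns i j)"
  by (rule finite_subset[of _ "(\<lambda>(a, b1, b2, c1, c2, c3). (b1, b2, c1, c2, c3)) ` patterns"])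
     (force simp: highest_patterns_def finite_patterns)+

lemma finite_pS_solutions:
  "finite {v :: nat \<times> nat \<times> nat \<times> nat. case v of (x1, x2, x3, x4) \<Rightarrow>
      int x1 + int x3 + int x4 = n \<and> int x2 + int x3 + 2 * int x4 = m}"
  by (rule finite_subset[of _ "{..nat n} \<times> {..nat m} \<times> {..nat n} \<times> {..nat n}"]) auto

text \<open>Patterns with \<open>b1 < c1\<close> inject into those for \<open>j - 1\<close> by
  raising \<open>b1\<close>, which leaves \<open>i\<close> unchanged; those with
  \<open>b1 = c1\<close> inject into the solutions.\<close>

lemma card_highest_patterns_le:
  "card (highest_patterns i j) \<le> card (highest_patterns i (j - 1)) + pS (j - l3 - l4) (i + j - l2 - l3 - 2 * l4)"
proof -
  let ?H = "highest_patterns i j"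
  let ?f = "\<lambda>(b1, b2, c1, c2, c3). (b1 + 1, b2, c1, c2, c3) :: int \<times> int \<times> int \<times> int \<times> int"
  \<comment> \<open>These are \<open>x1\<close>, \<open>x2\<close>, \<open>x3\<close>,
    \<open>x4\<close>. When \<open>b1 = c1\<close>, the equation for \<open>j\<close> becomes the
    first one of \<open>pS\<close>, and that for \<open>i + j\<close> the second.\<close>
  let ?g = "\<lambda>(b1, b2, c1, c2, c3). (nat (c2 - b2), nat (l3 - c3), nat (l2 - c2), nat (l1 - c1))"
  let ?X = "{(b1, b2, c1, c2, c3) \<in> ?H. b1 < c1}" and ?Y = "{(b1, b2, c1, c2, c3) \<in> ?H. b1 = c1}"
  have "card ?X \<le> card (highest_patterns i (j - 1))"
    by (rule card_inj_on_le[of ?f])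
       (auto simp: inj_on_def finite_highest_patterns, auto simp: highest_patterns_def patterns_def)
  moreover have "card ?Y \<le> pS (j - l3 - l4) (i + j - l2 - l3 - 2 * l4)"
  \<comment> \<open>\<open>pS\<close> is 0 by convention at negative arguments; a member of
    \<open>?Y\<close> shows that both are nonnegative.\<close>
  proof (cases "?Y = {}")
    case True
    then show ?thesis by (simp only: card.empty le0)
  next
    case False
    then have "0 \<le> j - l3 - l4" "0 \<le> i + j - l2 - l3 - 2 * l4"
      by (auto simp: highest_patterns_def patterns_def total_def)
    then have "\<not> (j - l3 - l4 < 0 \<or> i + j - l2 - l3 - 2 * l4 < 0)"
      by linarith
    moreover have "inj_on ?g ?Y"
      by (rule inj_on_inverseI[of _ "\<lambda>(x1, x2, x3, x4).
            (l1 - int x4, l2 - int x3 - int x1, l1 - int x4, l2 - int x3, l3 - int x2)"])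
         (auto simp: highest_patterns_def patterns_def)
    then have "card ?Y \<le> card {(x1, x2, x3, x4). int x1 + int x3 + int x4 = j - l3 - l4
        \<and> int x2 + int x3 + 2 * int x4 = i + j - l2 - l3 - 2 * l4}"
      by (rule card_inj_on_le[OF _ _ finite_pS_solutions])
         (auto simp: highest_patterns_def patterns_def total_def)
    ultimately show ?thesis
      unfolding pS_def by (simp only: if_False)
  qed
  moreover have H: "?H = ?X \<union> ?Y"
    by (auto simp: highest_patterns_def patterns_def)
  then have "card ?H \<le> card ?X + card ?Y"
    using arg_cong[OF H, of card] card_Un_le[of ?X ?Y] by linarith
  ultimately show ?thesis by linarith
qed

text \<open>\<open>weight_count_diff\<close> varies the second argument, so the exchange symmetry is
  used to move \<open>i\<close> there.\<close>

lemma weight_count_second_diff_le: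
  assumes "2 * i \<le> total"
  shows "int (weight_count i j) - int (weight_count (i - 1) j)
    - int (weight_count i (j - 1)) + int (weight_count (i - 1) (j - 1))
    \<le> int (pS (j - l3 - l4) (i + j - l2 - l3 - 2 * l4))"
  using weight_count_diff[OF assms, of j] weight_count_diff[OF assms, of "j - 1"]
    card_highest_patterns_le[of i j]
  unfolding weight_count_swap[of _ j] weight_count_swap[of _ "j - 1"] by linarith

end

subsection \<open>Tableaux and Gelfand--Tsetlin patterns\<close>

text \<open>Values off the triangle are fixed (zero, or \<open>L\<close> from row \<open>N\<close>
  on), so that tableaux correspond bijectively to functions.\<close>

definition gt_patterns :: "nat \<Rightarrow> (nat \<Rightarrow> nat) \<Rightarrow> (nat \<Rightarrow> nat \<Rightarrow> nat) set" where
  "gt_patterns N L = {g. (\<forall>r. g 0 r = 0) \<and> (\<forall>k r. N \<le> k \<longrightarrow> g k r = L r)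
     \<and> (\<forall>k r. g k r \<le> g (Suc k) r) \<and> (\<forall>k r. k < N \<longrightarrow> g (Suc k) (Suc r) \<le> g k r)}"

text \<open>\<open>g k r\<close> is the number of entries smaller than \<open>k\<close> in row \<open>r\<close>; rows and entries start at 0.\<close>

definition pattern_of :: "(nat \<Rightarrow> nat) \<Rightarrow> (nat \<times> nat \<Rightarrow> nat) \<Rightarrow> nat \<Rightarrow> nat \<Rightarrow> nat" where
  "pattern_of L T k r = card {j. j < L r \<and> T (r, j) < k}"

text \<open>The entry is the first \<open>k\<close> for which the shape of the entries up to
  \<open>k\<close> contains the cell; the default 0 agrees with \<open>ssyt\<close>.\<close>

definition tableau_of :: "(nat \<Rightarrow> nat) \<Rightarrow> (nat \<Rightarrow> nat \<Rightarrow> nat) \<Rightarrow> nat \<times> nat \<Rightarrow> nat" where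
  "tableau_of L g = (\<lambda>(r, j). if j < L r then LEAST k. j < g (Suc k) r else 0)"

definition row_length :: "nat list \<Rightarrow> nat \<Rightarrow> nat" where
  "row_length la r = (if r < length la then la ! r else 0)"

lemma cells_eq: "cells la = {(i, j). j < row_length la i}"
  by (auto simp: cells_def row_length_def split: if_splits)

lemma finite_cells: "finite (cells la)"
  by (rule finite_subset[of _ "SIGMA i:{..<length la}. {..<la ! i}"]) (auto simp: cells_def)

lemma row_length_antimono:
  assumes "is_partition la"
  shows "row_length la (Suc r) \<le> row_length la r"
  using assms by (auto simp: is_partition_def row_length_def sorted_wrt_iff_nth_less)

text \<open>Rows increase weakly, so the entries below \<open>k\<close> fill an initial segment
  whose length decides membership.\<close>

lemma less_pattern_of_iff:
  assumes "T \<in> ssyt N la"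
  shows "j < pattern_of (row_length la) T k r \<longleftrightarrow> j < row_length la r \<and> T (r, j) < k"
proof -
  let ?S = "{j. j < row_length la r \<and> T (r, j) < k}"
  have step: "T (r, j) \<le> T (r, Suc j)" if "Suc j < row_length la r" for j
    using assms that by (auto simp: ssyt_def cells_eq)
  have mono: "T (r, i) \<le> T (r, j)" if "i \<le> j" "j < row_length la r" for i j
    using that by (induction j rule: dec_induct) (use step in \<open>force intro: order_trans\<close>)+
  have "?S = {..<card ?S}"
  proof -
    have "j \<in> ?S" if "i \<in> ?S" "j < i" for i j
      using that mono[of j i] by auto
    then have "{..<Suc i} \<subseteq> ?S" if "i \<in> ?S" for i
      using that by (auto simp: less_Suc_eq)
    then have "i < card ?S" if "i \<in> ?S" for i
      using that card_mono[of ?S "{..<Suc i}"] by fastforce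
    then have "?S \<subseteq> {..<card ?S}" by auto
    then show ?thesis by (intro card_subset_eq) auto
  qed
  then show ?thesis by (auto simp: pattern_of_def)
qed

lemma gt_patterns_mono:
  assumes g: "g \<in> gt_patterns N L" and "k \<le> k'"
  shows "g k r \<le> g k' r"
  using assms(2)
proof (induction k' rule: dec_induct)
  case (step m)
  moreover have "g m r \<le> g (Suc m) r" using g by (simp add: gt_patterns_def)
  ultimately show ?case by linarith
qed simp

lemma tableau_of_less_iff:
  assumes g: "g \<in> gt_patterns N L" and j: "j < L r"
  shows "tableau_of L g (r, j) < k \<longleftrightarrow> j < g k r"
proof -
  have ex: "j < g (Suc N) r" using g j by (auto simp: gt_patterns_def)
  show ?thesis
  proof (cases k)
    case 0
    then show ?thesis using g by (auto simp: gt_patterns_def)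
  next
    case (Suc m)
    have "(LEAST k. j < g (Suc k) r) \<le> m \<longleftrightarrow> j < g (Suc m) r"
    proof
      assume "(LEAST k. j < g (Suc k) r) \<le> m"
      with LeastI[of "\<lambda>k. j < g (Suc k) r", OF ex] gt_patterns_mono[OF g] show "j < g (Suc m) r"
        by (meson Suc_le_mono order_less_le_trans)
    qed (rule Least_le)
    then show ?thesis using j Suc by (simp add: tableau_of_def less_Suc_eq_le)
  qed
qed

lemma pattern_of_in_gt_patterns:
  assumes T: "T \<in> ssyt N la" and la: "is_partition la"
  shows "pattern_of (row_length la) T \<in> gt_patterns N (row_length la)"
proof -
  let ?L = "row_length la" and ?g = "pattern_of (row_length la) T"
  note less = less_pattern_of_iff[OF T]
  have bound: "T (r, j) < N" if "j < ?L r" for r j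
    using T that by (auto simp: ssyt_def cells_eq)
  have col: "T (r, j) < T (Suc r, j)" if "j < ?L (Suc r)" for r j
    using T that by (auto simp: ssyt_def cells_eq)
  have "?g k r = ?L r" if "N \<le> k" for k r
  proof -
    have "{j. j < ?L r \<and> T (r, j) < k} = {..<?L r}"
      using bound[of _ r] that by (auto intro: order_less_le_trans)
    then show ?thesis by (simp add: pattern_of_def)
  qed
  moreover have "?g k r \<le> ?g (Suc k) r" for k r
    unfolding pattern_of_def by (rule card_mono) auto
  moreover have "?g (Suc k) (Suc r) \<le> ?g k r" for k r
  \<comment> \<open>Otherwise the cell of row \<open>Suc r\<close> in column \<open>?g k r\<close>
    has entry at most \<open>k\<close>; the cell above it is then below \<open>k\<close> and already
    counted in \<open>?g k r\<close>.\<close>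
  proof (rule ccontr)
    assume "\<not> ?thesis"
    then have "?g k r < ?g (Suc k) (Suc r)" by simp
    with less have *: "?g k r < ?L (Suc r)" "T (Suc r, ?g k r) < Suc k" by auto
    with col[of "?g k r" r] have "T (r, ?g k r) < k" by simp
    moreover have "?g k r < ?L r" using * row_length_antimono[OF la, of r] by simp
    ultimately have "?g k r < ?g k r" using less by blast
    then show False by simp
  qed
  ultimately show ?thesis by (auto simp: gt_patterns_def pattern_of_def)
qed

lemma tableau_of_in_ssyt:
  assumes g: "g \<in> gt_patterns N (row_length la)" and la: "is_partition la"
  shows "tableau_of (row_length la) g \<in> ssyt N la"
proof -
  let ?L = "row_length la" and ?T = "tableau_of (row_length la) g"
  note less = tableau_of_less_iff[OF g]
  have "?T (r, j) < N" if "j < ?L r" for r j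
    using that less g by (auto simp: gt_patterns_def)
  moreover have "?T (r, j) \<le> ?T (r, Suc j)" if "Suc j < ?L r" for r j
    using less[of j r "Suc (?T (r, Suc j))"] less[of "Suc j" r "Suc (?T (r, Suc j))"] that by simp
  moreover have "?T (r, j) < ?T (Suc r, j)" if "j < ?L (Suc r)" for r j
  proof -
    have jr: "j < ?L r" using that row_length_antimono[OF la, of r] by simp
    have "?T (Suc r, j) < N" using that less g by (auto simp: gt_patterns_def)
    moreover have "j < g (Suc (?T (Suc r, j))) (Suc r)" using less[OF that] by blast
    ultimately have "j < g (?T (Suc r, j)) r"
      using g by (auto simp: gt_patterns_def intro: order_less_le_trans)
    then show ?thesis using less[OF jr] by blast
  qed
  ultimately show ?thesis by (auto simp: ssyt_def cells_eq tableau_of_def)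
qed

lemma tableau_of_pattern_of:
  assumes T: "T \<in> ssyt N la" and la: "is_partition la"
  shows "tableau_of (row_length la) (pattern_of (row_length la) T) = T"
proof
  fix c :: "nat \<times> nat"
  obtain r j where c: "c = (r, j)" by fastforce
  show "tableau_of (row_length la) (pattern_of (row_length la) T) c = T c"
  proof (cases "j < row_length la r")
    case True
    have "tableau_of (row_length la) (pattern_of (row_length la) T) (r, j) < k \<longleftrightarrow> T (r, j) < k" for k
      using True tableau_of_less_iff[OF pattern_of_in_gt_patterns[OF assms] True] less_pattern_of_iff[OF T]
      by blast
    then show ?thesis unfolding c by (meson linorder_neqE_nat less_irrefl)
  next
    case False
    then show ?thesis using T by (auto simp: c tableau_of_def ssyt_def cells_eq)
  qed
qed

lemma pattern_of_tableau_of: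
  assumes g: "g \<in> gt_patterns N (row_length la)"
  shows "pattern_of (row_length la) (tableau_of (row_length la) g) = g"
proof (intro ext)
  fix k r
  have "g k r \<le> row_length la r"
    using gt_patterns_mono[OF g, of k "max k N"] g by (auto simp: gt_patterns_def)
  then have "{j. j < row_length la r \<and> tableau_of (row_length la) g (r, j) < k} = {..<g k r}"
    using tableau_of_less_iff[OF g] by auto
  then show "pattern_of (row_length la) (tableau_of (row_length la) g) k r = g k r"
    by (simp add: pattern_of_def)
qed

lemma card_cells_with_entry:
  assumes T: "T \<in> ssyt N la" and "length la \<le> N"
  shows "card {c\<in>cells la. T c = k} =
    (\<Sum>r<N. pattern_of (row_length la) T (Suc k) r - pattern_of (row_length la) T k r)"
proof -
  let ?L = "row_length la"
  have "{c\<in>cells la. T c = k} = (SIGMA r:{..<N}. {j. j < ?L r \<and> T (r, j) < Suc k} - {j. j < ?L r \<and> T (r, j) < k})"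
    using assms(2) by (auto simp: cells_def row_length_def split: if_splits)
  moreover have "card ({j. j < ?L r \<and> T (r, j) < Suc k} - {j. j < ?L r \<and> T (r, j) < k}) =
      pattern_of ?L T (Suc k) r - pattern_of ?L T k r" for r
    unfolding pattern_of_def by (rule card_Diff_subset) auto
  ultimately show ?thesis by simp
qed

lemma schur_eq_sum_gt_patterns:
  assumes la: "is_partition la" "length la \<le> N"
  shows "schur N la x = (\<Sum>g\<in>gt_patterns N (row_length la). \<Prod>k<N. x k ^ (\<Sum>r<N. g (Suc k) r - g k r))"
proof -
  have "(\<Prod>c\<in>cells la. x (T c)) = (\<Prod>k<N. x k ^ (\<Sum>r<N. pattern_of (row_length la) T (Suc k) r - pattern_of (row_length la) T k r))"
    if T: "T \<in> ssyt N la" for T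
  proof -
    have "T ` cells la \<subseteq> {..<N}" using T by (auto simp: ssyt_def)
    from prod.group[OF finite_cells finite_lessThan this, of "\<lambda>c. x (T c)"]
    have "(\<Prod>c\<in>cells la. x (T c)) = (\<Prod>k<N. \<Prod>c\<in>{c\<in>cells la. T c = k}. x (T c))" by simp
    also have "\<dots> = (\<Prod>k<N. x k ^ card {c\<in>cells la. T c = k})"
      by (intro prod.cong refl) simp
    finally show ?thesis using card_cells_with_entry[OF T la(2)] by simp
  qed
  then show ?thesis
    unfolding schur_def
    by (intro sum.reindex_bij_witness[of _ "tableau_of (row_length la)" "pattern_of (row_length la)"])
       (use la in \<open>simp_all add: tableau_of_pattern_of pattern_of_tableau_of tableau_of_in_ssyt pattern_of_in_gt_patterns\<close>)
qed

section \<open>Schur polynomials in two variables and in the four products of variables\<close>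

lemma gt_patternsD:
  assumes "g \<in> gt_patterns N L"
  shows "g 0 r = 0" "N \<le> k \<Longrightarrow> g k r = L r" "g k r \<le> g (Suc k) r" "k < N \<Longrightarrow> g (Suc k) (Suc r) \<le> g k r"
  using assms by (auto simp: gt_patterns_def)

lemma gt_patterns_eq_0:
  assumes "g \<in> gt_patterns N L" "k \<le> r" "k \<le> N"
  shows "g k r = 0"
  using assms(2,3)
proof (induction k arbitrary: r)
  case 0
  then show ?case using gt_patternsD(1)[OF assms(1)] by simp
next
  case (Suc k)
  then obtain r' where "r = Suc r'" by (cases r) auto
  then show ?case using Suc gt_patternsD(4)[OF assms(1), of k r'] by simp
qed


text \<open>A pattern has one free entry \<open>g 1 0\<close>; the exponent \<open>n - g 1 0\<close>
  runs through the weight string of an irreducible \<open>gl_2\<close>-module.\<close>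

lemma schur_2:
  assumes "is_partition m" "length m \<le> 2" "sum_list m = n"
  shows "schur 2 m x = (\<Sum>i\<in>{part m 2..n - part m 2}. x 0 ^ (n - i) * x 1 ^ i)"
proof -
  let ?L = "row_length m"
  have L0: "?L r = 0" if "2 \<le> r" for r
    using assms that by (simp add: row_length_def)
  have L: "?L 0 + ?L 1 = n" "?L 1 = part m 2" "?L 1 \<le> ?L 0"
    using assms row_length_antimono[OF assms(1), of 0]
    by (auto simp: row_length_def part_def numeral_2_eq_2 le_Suc_eq length_Suc_conv)
  have "schur 2 m x = (\<Sum>g\<in>gt_patterns 2 ?L. \<Prod>k<2. x k ^ (\<Sum>r<2. g (Suc k) r - g k r))"
    by (rule schur_eq_sum_gt_patterns[OF assms(1,2)])
  also have "\<dots> = (\<Sum>i\<in>{part m 2..n - part m 2}. x 0 ^ (n - i) * x 1 ^ i)"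
  proof (rule sum.reindex_bij_witness[of _
      "\<lambda>i k r. if k = 0 then 0 else if k = 1 then (if r = 0 then n - i else 0) else ?L r" "\<lambda>g. n - g 1 0"])
    fix g assume g: "g \<in> gt_patterns 2 ?L"
    note g0 = gt_patternsD(1)[OF g] and g2 = gt_patternsD(2)[OF g]
    have g1: "g (Suc 0) (Suc r) = 0" for r using gt_patterns_eq_0[OF g, of "Suc 0" "Suc r"] by simp
    have "g (Suc 0) 0 \<le> g 2 0" "g 2 (Suc 0) \<le> g (Suc 0) 0"
      using gt_patternsD(3)[OF g, of "Suc 0" 0] gt_patternsD(4)[OF g, of "Suc 0" 0]
      by (simp_all add: numeral_2_eq_2)
    then have b: "?L 1 \<le> g 1 0" "g 1 0 \<le> ?L 0" by (simp_all add: g2)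
    have b': "g 1 0 \<le> n" using b L(1) by simp
    show "n - g 1 0 \<in> {part m 2..n - part m 2}" using b L by auto
    show "(\<lambda>k r. if k = 0 then 0 else if k = 1 then (if r = 0 then n - (n - g 1 0) else 0) else ?L r) = g"
    proof (intro ext)
      fix k r :: nat
      consider "k = 0" | "k = 1" | "2 \<le> k" by linarith
      then show "(if k = 0 then 0 else if k = 1 then (if r = 0 then n - (n - g 1 0) else 0) else ?L r) = g k r"
        by cases (use b' g0 g1 g2 in \<open>cases r; simp\<close>)+
    qed
    show "x 0 ^ (n - (n - g 1 0)) * x 1 ^ (n - g 1 0) = (\<Prod>k<2. x k ^ (\<Sum>r<2. g (Suc k) r - g k r))"
      using b b' L(1) g0 g1 g2 by (simp add: numeral_2_eq_2)
  next
    fix i assume "i \<in> {part m 2..n - part m 2}"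
    then have i: "?L 1 \<le> i" "i \<le> n - ?L 1" using L(2) by auto
    then show "n - (if (1::nat) = 0 then 0 else if (1::nat) = 1 then if (0::nat) = 0 then n - i else 0 else ?L 0) = i" by simp
    show "(\<lambda>k r. if k = 0 then 0 else if k = 1 then (if r = 0 then n - i else 0) else ?L r) \<in> gt_patterns 2 ?L"
      using i L L0 by (auto simp: gt_patterns_def less_2_cases_iff)
  qed
  finally show ?thesis .
qed

definition pattern4 :: "(nat \<Rightarrow> nat) \<Rightarrow> int \<times> int \<times> int \<times> int \<times> int \<times> int \<Rightarrow> nat \<Rightarrow> nat \<Rightarrow> nat" where
  "pattern4 L = (\<lambda>(a, b1, b2, c1, c2, c3) k r.
     if k = 0 then 0
     else if k = 1 then (if r = 0 then nat a else 0)
     else if k = 2 then (if r = 0 then nat b1 else if r = 1 then nat b2 else 0)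
     else if k = 3 then (if r = 0 then nat c1 else if r = 1 then nat c2 else if r = 2 then nat c3 else 0)
     else L r)"

lemma gt_patterns_4_facts:
  assumes g: "g \<in> gt_patterns 4 L"
  shows "g 0 r = 0" "g 1 1 = 0" "g 1 2 = 0" "g 1 3 = 0" "g 2 2 = 0" "g 2 3 = 0" "g 3 3 = 0" "g 4 r = L r"
    "g 1 0 \<le> g 2 0" "g 2 0 \<le> g 3 0" "g 2 1 \<le> g 3 1" "g 3 0 \<le> L 0" "g 3 1 \<le> L 1" "g 3 2 \<le> L 2"
    "g 2 1 \<le> g 1 0" "g 3 1 \<le> g 2 0" "g 3 2 \<le> g 2 1" "L 1 \<le> g 3 0" "L 2 \<le> g 3 1" "L 3 \<le> g 3 2"
  using gt_patternsD(3)[OF g, of 1 0] gt_patternsD(3)[OF g, of 2 0] gt_patternsD(3)[OF g, of 2 1]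
    gt_patternsD(3)[OF g, of 3 0] gt_patternsD(3)[OF g, of 3 1] gt_patternsD(3)[OF g, of 3 2]
    gt_patternsD(4)[OF g, of 1 0] gt_patternsD(4)[OF g, of 2 0] gt_patternsD(4)[OF g, of 2 1]
    gt_patternsD(4)[OF g, of 3 0] gt_patternsD(4)[OF g, of 3 1] gt_patternsD(4)[OF g, of 3 2]
    gt_patternsD(2)[OF g, of 4]
  by (simp_all add: gt_patterns_eq_0[OF g] eval_nat_numeral)

lemma pattern4_inverse:
  assumes g: "g \<in> gt_patterns 4 L"
  shows "pattern4 L (int (g 1 0), int (g 2 0), int (g 2 1), int (g 3 0), int (g 3 1), int (g 3 2)) = g"
proof (intro ext)
  fix k r :: nat
  consider "k = 0" | "k = 1" | "k = 2" | "k = 3" | "4 \<le> k" by linarith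
  then show "pattern4 L (int (g 1 0), int (g 2 0), int (g 2 1), int (g 3 0), int (g 3 1), int (g 3 2)) k r = g k r"
    by cases (use gt_patterns_4_facts(1)[OF g] gt_patterns_eq_0[OF g] gt_patternsD(2)[OF g]
      in \<open>auto simp: pattern4_def\<close>)
qed

lemma pattern4_in_gt_patterns:
  assumes "four_parts (int (L 0)) (int (L 1)) (int (L 2)) (int (L 3))" and L0: "\<And>r. 4 \<le> r \<Longrightarrow> L r = 0"
    and t: "t \<in> four_parts.patterns (int (L 0)) (int (L 1)) (int (L 2)) (int (L 3))"
  shows "pattern4 L t \<in> gt_patterns 4 L"
proof -
  interpret four_parts "int (L 0)" "int (L 1)" "int (L 2)" "int (L 3)" by fact
  obtain a b1 b2 c1 c2 c3 where teq: "t = (a, b1, b2, c1, c2, c3)" by (cases t) auto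
  note ineqs = t[unfolded teq patterns_def, simplified]
  let ?g = "pattern4 L t"
  have "?g k r \<le> ?g (Suc k) r" for k r
  proof -
    consider "k = 0" | "k = 1" | "k = 2" | "k = 3" | "4 \<le> k" by linarith
    then show ?thesis by cases (use ineqs in \<open>auto simp: pattern4_def teq\<close>)
  qed
  moreover have "?g (Suc k) (Suc r) \<le> ?g k r" if "k < 4" for k r
  proof -
    have "k = 0 \<or> k = 1 \<or> k = 2 \<or> k = 3 \<and> (r = 0 \<or> r = 1 \<or> r = 2 \<or> 3 \<le> r)"
      using that by arith
    then consider "k = 0" | "k = 1" | "k = 2" | "k = 3" "r = 0" | "k = 3" "r = 1" | "k = 3" "r = 2" | "k = 3" "3 \<le> r"
      by blast
    then show ?thesis by cases (use ineqs L0[of "Suc r"] in \<open>auto simp: pattern4_def teq eval_nat_numeral\<close>)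
  qed
  moreover have "?g 0 r = 0" "4 \<le> k \<Longrightarrow> ?g k r = L r" for k r
    by (auto simp: pattern4_def teq)
  ultimately show ?thesis by (auto simp: gt_patterns_def)
qed

text \<open>\<open>x 1\<close> occurs in variables 2 and 3, \<open>y 1\<close> in variables 1 and 3;
  homogeneity fixes the other exponents.\<close>

lemma prod_prodvars_power:
  assumes "e 0 + e 1 + e 2 + e 3 = n"
  shows "(\<Prod>k<4. prodvars x y k ^ e k) =
    (x 0 ^ (n - (e 2 + e 3)) * x 1 ^ (e 2 + e 3)) * (y 0 ^ (n - (e 1 + e 3)) * y 1 ^ (e 1 + e 3))"
proof -
  have "n - (e 2 + e 3) = e 0 + e 1" "n - (e 1 + e 3) = e 0 + e 2" using assms by auto
  moreover have "{..<4 :: nat} = {0, 1, 2, 3}" by auto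
  ultimately show ?thesis by (simp add: prodvars_def power_add power_mult_distrib mult_ac)
qed

lemma four_parts_row_length:
  assumes "is_partition la"
  shows "four_parts (int (row_length la 0)) (int (row_length la 1)) (int (row_length la 2)) (int (row_length la 3))"
  using row_length_antimono[OF assms, of 0] row_length_antimono[OF assms, of 1] row_length_antimono[OF assms, of 2]
  by unfold_locales (simp_all add: eval_nat_numeral)

lemma sum_row_length:
  assumes "length la \<le> 4"
  shows "row_length la 0 + row_length la 1 + row_length la 2 + row_length la 3 = sum_list la"
  using assms by (auto simp: row_length_def eval_nat_numeral le_Suc_eq length_Suc_conv)

lemma schur_4_prodvars:
  fixes la :: "nat list"
  defines "n \<equiv> sum_list la"
  defines "F \<equiv> four_parts.weight_count (int (row_length la 0)) (int (row_length la 1)) (int (row_length la 2)) (int (row_length la 3))"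
  assumes la: "is_partition la" "length la \<le> 4"
  shows "schur 4 la (prodvars x y) =
    (\<Sum>i\<le>n. \<Sum>j\<le>n. real (F (int i) (int j)) * (x 0 ^ (n - i) * x 1 ^ i) * (y 0 ^ (n - j) * y 1 ^ j))"
proof -
  let ?L = "row_length la"
  interpret four_parts "int (?L 0)" "int (?L 1)" "int (?L 2)" "int (?L 3)"
    by (rule four_parts_row_length[OF la(1)])
  have n: "?L 0 + ?L 1 + ?L 2 + ?L 3 = n" unfolding n_def by (rule sum_row_length[OF la(2)])
  then have total: "total = int n" unfolding total_def by linarith
  have L0: "?L r = 0" if "4 \<le> r" for r using la(2) that by (simp add: row_length_def)
  define wt where "wt = (\<lambda>(a, b1, b2, c1, c2, c3).
      (nat (total - b1 - b2), nat ((b1 + b2 - a) + (total - c1 - c2 - c3))))"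
  define monomial where "monomial = (\<lambda>(i, j). (x 0 ^ (n - i) * x 1 ^ i) * (y 0 ^ (n - j) * y 1 ^ j))"
  have "schur 4 la (prodvars x y) =
      (\<Sum>g\<in>gt_patterns 4 ?L. \<Prod>k<4. prodvars x y k ^ (\<Sum>r<4. g (Suc k) r - g k r))"
    by (rule schur_eq_sum_gt_patterns[OF la])
  also have "\<dots> = (\<Sum>t\<in>patterns. monomial (wt t))"
  proof (rule sum.reindex_bij_witness[of _ "pattern4 ?L"
        "\<lambda>g. (int (g 1 0), int (g 2 0), int (g 2 1), int (g 3 0), int (g 3 1), int (g 3 2))"])
    fix g assume g: "g \<in> gt_patterns 4 ?L"
    let ?t = "(int (g 1 0), int (g 2 0), int (g 2 1), int (g 3 0), int (g 3 1), int (g 3 2))"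
    show "pattern4 ?L ?t = g" by (rule pattern4_inverse[OF g])
    show "?t \<in> patterns"
      unfolding patterns_def using gt_patterns_4_facts[OF g] by simp
    define e where "e k = (\<Sum>r<4. g (Suc k) r - g k r)" for k
    have 4: "{..<4 :: nat} = {0, 1, 2, 3}" by auto
    have e: "e 0 = g 1 0" "e 1 = (g 2 0 - g 1 0) + g 2 1"
      "e 2 = (g 3 0 - g 2 0) + (g 3 1 - g 2 1) + g 3 2"
      "e 3 = (?L 0 - g 3 0) + (?L 1 - g 3 1) + (?L 2 - g 3 2) + ?L 3"
      using gt_patterns_4_facts[OF g] by (simp_all add: e_def 4 flip: numeral_2_eq_2)
    have en: "e 0 + e 1 + e 2 + e 3 = n" using e n gt_patterns_4_facts[OF g] by linarith
    have "int (e 2 + e 3) = total - int (g 2 0) - int (g 2 1)"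
      "int (e 1 + e 3) = (int (g 2 0) + int (g 2 1) - int (g 1 0)) + (total - int (g 3 0) - int (g 3 1) - int (g 3 2))"
      using e n gt_patterns_4_facts[OF g] unfolding total by linarith+
    then have "wt ?t = (e 2 + e 3, e 1 + e 3)"
      unfolding wt_def prod.case by (metis nat_int)
    then show "monomial (wt ?t) = (\<Prod>k<4. prodvars x y k ^ (\<Sum>r<4. g (Suc k) r - g k r))"
      unfolding e_def[symmetric] prod_prodvars_power[OF en] by (simp add: monomial_def)
  next
    fix t assume t: "t \<in> patterns"
    show "pattern4 ?L t \<in> gt_patterns 4 ?L"
      by (rule pattern4_in_gt_patterns[OF four_parts_axioms L0 t])
    obtain a b1 b2 c1 c2 c3 where teq: "t = (a, b1, b2, c1, c2, c3)" by (cases t) auto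
    show "(int (pattern4 ?L t 1 0), int (pattern4 ?L t 2 0), int (pattern4 ?L t 2 1), int (pattern4 ?L t 3 0),
        int (pattern4 ?L t 3 1), int (pattern4 ?L t 3 2)) = t"
      using t unfolding teq patterns_def by (auto simp: pattern4_def)
  qed
  also have "\<dots> = (\<Sum>p\<in>{..n} \<times> {..n}. \<Sum>t\<in>{t\<in>patterns. wt t = p}. monomial (wt t))"
  proof (rule sum.group[symmetric])
    show "wt ` patterns \<subseteq> {..n} \<times> {..n}"
    proof (rule image_subsetI)
      fix t assume "t \<in> patterns"
      moreover obtain a b1 b2 c1 c2 c3 where "t = (a, b1, b2, c1, c2, c3)" by (cases t) auto
      ultimately show "wt t \<in> {..n} \<times> {..n}"
        using pattern_weight_bounds[of a b1 b2 c1 c2 c3] unfolding total wt_def by (simp add: nat_le_iff)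
    qed
  qed (rule finite_patterns, simp)
  also have "\<dots> = (\<Sum>(i, j)\<in>{..n} \<times> {..n}. real (F (int i) (int j)) * monomial (i, j))"
  proof (rule sum.cong[OF refl], clarify)
    fix i j
    have eq: "{t\<in>patterns. wt t = (i, j)} = {(a, b1, b2, c1, c2, c3) \<in> patterns.
        total - b1 - b2 = int i \<and> (b1 + b2 - a) + (total - c1 - c2 - c3) = int j}"
    proof (rule set_eqI)
      fix t :: "int \<times> int \<times> int \<times> int \<times> int \<times> int"
      obtain a b1 b2 c1 c2 c3 where t: "t = (a, b1, b2, c1, c2, c3)" by (cases t) auto
      \<comment> \<open>\<open>nat\<close> is faithful only on nonnegative integers, hence the
        appeal to the weight bounds.\<close>
      have "wt t = (i, j) \<longleftrightarrow> total - b1 - b2 = int i \<and> (b1 + b2 - a) + (total - c1 - c2 - c3) = int j" if "t \<in> patterns"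
        using pattern_weight_bounds[OF that[unfolded t]] unfolding total wt_def t by auto
      then show "t \<in> {t\<in>patterns. wt t = (i, j)} \<longleftrightarrow> t \<in> {(a, b1, b2, c1, c2, c3) \<in> patterns.
          total - b1 - b2 = int i \<and> (b1 + b2 - a) + (total - c1 - c2 - c3) = int j}"
        unfolding t mem_Collect_eq prod.case by blast
    qed
    have "(\<Sum>t\<in>{t\<in>patterns. wt t = (i, j)}. monomial (wt t)) = real (card {t\<in>patterns. wt t = (i, j)}) * monomial (i, j)"
      by simp
    then show "(\<Sum>t\<in>{t\<in>patterns. wt t = (i, j)}. monomial (wt t)) = real (F (int i) (int j)) * monomial (i, j)"
      unfolding F_def weight_count_def eq .
  qed
  finally show ?thesis by (simp add: monomial_def sum.cartesian_product mult_ac)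
qed

subsection \<open>Expansion in products of two-variable Schur polynomials\<close>

text \<open>Partitions here carry no zero parts, so the list shortens when \<open>k\<close> or
  \<open>n\<close> vanishes.\<close>

definition two_row :: "nat \<Rightarrow> nat \<Rightarrow> nat list" where
  "two_row n k = (if n = 0 then [] else if k = 0 then [n] else [n - k, k])"

lemma two_row_in_partitions_upto: "k \<le> n div 2 \<Longrightarrow> two_row n k \<in> partitions_upto n 2"
  by (auto simp: two_row_def partitions_upto_def is_partition_def)

lemma part_two_row: "k \<le> n div 2 \<Longrightarrow> part (two_row n k) 2 = k"
  by (auto simp: two_row_def part_def)

lemma two_row_part:
  assumes "p \<in> partitions_upto n 2"
  shows "two_row n (part p 2) = p" "part p 2 \<le> n div 2"
proof -
  have "length p \<le> 2" using assms by (simp add: partitions_upto_def)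
  then consider "p = []" | a where "p = [a]" | a b where "p = [a, b]"
    by (auto simp: numeral_2_eq_2 le_Suc_eq length_Suc_conv)
  then show "two_row n (part p 2) = p" "part p 2 \<le> n div 2"
    using assms by (cases; auto simp: two_row_def part_def partitions_upto_def is_partition_def)+
qed

lemma sum_partitions_upto_2:
  "(\<Sum>p\<in>partitions_upto n 2. f p) = (\<Sum>k\<le>n div 2. f (two_row n k))"
  by (rule sum.reindex_bij_witness[of _ "two_row n" "\<lambda>p. part p 2"])
     (auto simp: two_row_part two_row_in_partitions_upto part_two_row)

text \<open>A position \<open>i\<close> lies in the string from \<open>m\<close> to
  \<open>n - m\<close> exactly when \<open>m \<le> min i (n - i)\<close>, so the coefficients become
  prefix sums.\<close>

lemma sum_strings:
  fixes c f :: "nat \<Rightarrow> real"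
  shows "(\<Sum>m\<le>n div 2. c m * (\<Sum>i\<in>{m..n - m}. f i)) = (\<Sum>i\<le>n. (\<Sum>m\<le>min i (n - i). c m) * f i)"
proof -
  have "(\<Sum>m\<le>n div 2. c m * (\<Sum>i\<in>{m..n - m}. f i)) =
      (\<Sum>m\<le>n div 2. \<Sum>i\<in>{i\<in>{..n}. m \<le> i \<and> i \<le> n - m}. c m * f i)"
    by (auto simp: sum_distrib_left intro!: sum.cong)
  also have "\<dots> = (\<Sum>i\<le>n. \<Sum>m\<in>{m\<in>{..n div 2}. m \<le> i \<and> i \<le> n - m}. c m * f i)"
    by (rule sum.swap_restrict) auto
  also have "\<dots> = (\<Sum>i\<le>n. \<Sum>m\<le>min i (n - i). c m * f i)"
    by (intro sum.cong) auto
  finally show ?thesis by (simp add: sum_distrib_right)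
qed

lemma sum_strings2:
  fixes d :: "nat \<Rightarrow> nat \<Rightarrow> real"
  shows "(\<Sum>m\<le>n div 2. \<Sum>l\<le>n div 2. d m l * (\<Sum>i\<in>{m..n - m}. f i) * (\<Sum>j\<in>{l..n - l}. h j)) =
    (\<Sum>i\<le>n. \<Sum>j\<le>n. (\<Sum>m\<le>min i (n - i). \<Sum>l\<le>min j (n - j). d m l) * f i * h j)"
proof -
  have "(\<Sum>l\<le>n div 2. d m l * (\<Sum>i\<in>{m..n - m}. f i) * (\<Sum>j\<in>{l..n - l}. h j)) =
      (\<Sum>j\<le>n. (\<Sum>l\<le>min j (n - j). d m l) * h j) * (\<Sum>i\<in>{m..n - m}. f i)" for m
    unfolding sum_strings[symmetric, of _ n]
    by (subst sum_distrib_right, rule sum.cong) (simp_all add: mult_ac)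
  then have "(\<Sum>m\<le>n div 2. \<Sum>l\<le>n div 2. d m l * (\<Sum>i\<in>{m..n - m}. f i) * (\<Sum>j\<in>{l..n - l}. h j)) =
      (\<Sum>i\<le>n. (\<Sum>m\<le>min i (n - i). \<Sum>j\<le>n. (\<Sum>l\<le>min j (n - j). d m l) * h j) * f i)"
    by (simp add: sum_strings)
  also have "\<dots> = (\<Sum>i\<le>n. \<Sum>j\<le>n. (\<Sum>m\<le>min i (n - i). \<Sum>l\<le>min j (n - j). d m l) * f i * h j)"
    by (subst sum.swap) (simp add: sum_distrib_right sum_distrib_left mult_ac)
  finally show ?thesis .
qed

section \<open>Inverting prefix sums and identifying the Kronecker coefficient\<close>

lemma sum_backward_diff:
  fixes f :: "int \<Rightarrow> real"
  assumes "f (- 1) = 0"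
  shows "(\<Sum>l\<le>j. f (int l) - f (int l - 1)) = f (int j)"
  using assms by (induction j) auto

lemma sum_second_diff:
  fixes F :: "int \<Rightarrow> int \<Rightarrow> real"
  assumes "\<And>j. F (- 1) j = 0" "\<And>i. F i (- 1) = 0"
  shows "(\<Sum>m\<le>i. \<Sum>l\<le>j. F (int m) (int l) - F (int m - 1) (int l) - F (int m) (int l - 1)
      + F (int m - 1) (int l - 1)) = F (int i) (int j)"
proof -
  have "(\<Sum>l\<le>j. F (int m) (int l) - F (int m - 1) (int l) - F (int m) (int l - 1) + F (int m - 1) (int l - 1))
      = F (int m) (int j) - F (int m - 1) (int j)" for m
    using sum_backward_diff[of "\<lambda>l. F (int m) l - F (int m - 1) l" j] assms
    by (simp add: algebra_simps)
  then show ?thesis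
    using sum_backward_diff[of "\<lambda>m. F m (int j)" i] assms by simp
qed

lemma eq_of_prefix_sums_eq:
  fixes c d :: "nat \<Rightarrow> real"
  assumes "\<And>i. i \<le> K \<Longrightarrow> (\<Sum>m\<le>i. c m) = (\<Sum>m\<le>i. d m)" "i \<le> K"
  shows "c i = d i"
proof (cases i)
  case 0
  then show ?thesis using assms(1)[of 0] by simp
next
  case (Suc k)
  then show ?thesis using assms(1)[of k] assms(1)[of "Suc k"] assms(2) by simp
qed

lemma bivariate_polyfun_eq_coeffs:
  fixes c d :: "nat \<Rightarrow> nat \<Rightarrow> real"
  assumes "\<And>s t. (\<Sum>i\<le>n. \<Sum>j\<le>n. c i j * s ^ i * t ^ j) = (\<Sum>i\<le>n. \<Sum>j\<le>n. d i j * s ^ i * t ^ j)"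
    and "i \<le> n" "j \<le> n"
  shows "c i j = d i j"
proof -
  have "(\<Sum>i\<le>n. (\<Sum>j\<le>n. c i j * t ^ j) * s ^ i) = (\<Sum>i\<le>n. (\<Sum>j\<le>n. d i j * t ^ j) * s ^ i)" for s t
    using assms(1)[of s t] by (simp add: sum_distrib_left mult_ac)
  then have "(\<Sum>j\<le>n. c i j * t ^ j) = (\<Sum>j\<le>n. d i j * t ^ j)" for t
    using \<open>i \<le> n\<close> polyfun_eq_coeffs[of "\<lambda>i. \<Sum>j\<le>n. c i j * t ^ j" n "\<lambda>i. \<Sum>j\<le>n. d i j * t ^ j"] by blast
  then show ?thesis
    using \<open>j \<le> n\<close> polyfun_eq_coeffs[of "c i" n "d i"] by blast
qed

lemma part_eq_row_length: "part la (Suc r) = row_length la r"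
  by (simp add: part_def row_length_def)

text \<open>\<open>kron\<close> is a definite description, so existence and uniqueness of the
  expansion are both shown: its coefficients are those whose prefix sums are the monomial
  coefficients \<open>F\<close>.\<close>

lemma kron_eq_second_diff:
  fixes la :: "nat list"
  defines "n \<equiv> sum_list la"
  defines "F \<equiv> \<lambda>i j. real (four_parts.weight_count (int (row_length la 0)) (int (row_length la 1)) (int (row_length la 2)) (int (row_length la 3)) i j)"
  assumes la: "is_partition la" "length la \<le> 4"
    and mu: "mu \<in> partitions_upto n 2" and nu: "nu \<in> partitions_upto n 2"
  defines "i \<equiv> int (part mu 2)" and "j \<equiv> int (part nu 2)"
  shows "kron mu nu la = F i j - F (i - 1) j - F i (j - 1) + F (i - 1) (j - 1)"
proof -
  interpret four_parts "int (row_length la 0)" "int (row_length la 1)" "int (row_length la 2)" "int (row_length la 3)"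
    by (rule four_parts_row_length[OF la(1)])
  have total: "total = int n" using sum_row_length[OF la(2)] unfolding total_def n_def by linarith
  define D where "D m l = F (int m) (int l) - F (int m - 1) (int l) - F (int m) (int l - 1)
      + F (int m - 1) (int l - 1)" for m l :: nat
  define C where "C m l = (if m \<in> partitions_upto n 2 \<and> l \<in> partitions_upto n 2
      then D (part m 2) (part l 2) else 0)" for m l
  define monomial where "monomial z k = z 0 ^ (n - k) * z 1 ^ k" for z :: "nat \<Rightarrow> real" and k
  define expands where "expands c \<longleftrightarrow> (\<forall>x y. schur 4 la (prodvars x y) =
      (\<Sum>m\<in>partitions_upto n 2. \<Sum>l\<in>partitions_upto n 2. c m l * schur 2 m x * schur 2 l y))" for c
  have F_swap: "F a b = F b a" for a b unfolding F_def by (metis weight_count_swap)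
  have F_refl: "F a (int n - b) = F a b" for a b
    unfolding F_def using weight_count_reflect[of a b] total by simp
  \<comment> \<open>The symmetries fold every exponent pair into the quadrant up to
    \<open>n div 2\<close>, where prefix sums can be compared with \<open>F\<close>.\<close>
  have F_min: "F (int (min a (n - a))) (int (min b (n - b))) = F (int a) (int b)" if "a \<le> n" "b \<le> n" for a b
  proof -
    have 1: "F c (int (min b (n - b))) = F c (int b)" if "b \<le> n" for b c
      using F_refl[of c "int b"] that by (auto simp: min_def of_nat_diff)
    show ?thesis using 1[OF that(1)] 1[OF that(2)] F_swap by metis
  qed
  have lhs: "schur 4 la (prodvars x y) = (\<Sum>a\<le>n. \<Sum>b\<le>n. F (int a) (int b) * monomial x a * monomial y b)" for x y
    unfolding F_def monomial_def n_def by (rule schur_4_prodvars[OF la])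
  have schur2: "schur 2 (two_row n m) z = (\<Sum>a\<in>{m..n - m}. monomial z a)" if "m \<le> n div 2" for m z
    using two_row_in_partitions_upto[OF that] schur_2[of "two_row n m" n z] part_two_row[OF that]
    by (simp add: partitions_upto_def monomial_def)
  have rhs: "(\<Sum>m\<in>partitions_upto n 2. \<Sum>l\<in>partitions_upto n 2. c m l * schur 2 m x * schur 2 l y) =
      (\<Sum>a\<le>n. \<Sum>b\<le>n. (\<Sum>m\<le>min a (n - a). \<Sum>l\<le>min b (n - b). c (two_row n m) (two_row n l)) * monomial x a * monomial y b)"
    for c :: "nat list \<Rightarrow> nat list \<Rightarrow> real" and x y
    unfolding sum_partitions_upto_2 sum_strings2[symmetric]
    by (intro sum.cong refl) (simp add: schur2)
  have F0: "F a b = 0" if "a < 0 \<or> b < 0" for a b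
    unfolding F_def using weight_count_eq_0[OF that] by (simp only: of_nat_0)
  have prefix: "(\<Sum>m\<le>a. \<Sum>l\<le>b. D m l) = F (int a) (int b)" for a b
    unfolding D_def by (rule sum_second_diff) (rule F0, simp)+
  have C_two_row: "C (two_row n m) (two_row n l) = D m l" if "m \<le> n div 2" "l \<le> n div 2" for m l
    using that by (simp add: C_def two_row_in_partitions_upto part_two_row)
  have C: "expands C"
    unfolding expands_def
  proof (intro allI)
    fix x y
    have "(\<Sum>m\<le>min a (n - a). \<Sum>l\<le>min b (n - b). C (two_row n m) (two_row n l)) = F (int a) (int b)"
      if "a \<le> n" "b \<le> n" for a b
    proof -
      have "(\<Sum>m\<le>min a (n - a). \<Sum>l\<le>min b (n - b). C (two_row n m) (two_row n l)) =
          (\<Sum>m\<le>min a (n - a). \<Sum>l\<le>min b (n - b). D m l)"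
        by (intro sum.cong refl C_two_row) auto
      then show ?thesis using prefix F_min[OF that] by simp
    qed
    then show "schur 4 la (prodvars x y) =
        (\<Sum>m\<in>partitions_upto n 2. \<Sum>l\<in>partitions_upto n 2. C m l * schur 2 m x * schur 2 l y)"
      unfolding lhs rhs by (intro sum.cong refl) simp
  qed
  have unique: "c = C"
    if c: "expands c" and c0: "\<forall>m l. m \<notin> partitions_upto n 2 \<or> l \<notin> partitions_upto n 2 \<longrightarrow> c m l = 0" for c
  proof -
    let ?c = "\<lambda>m l. c (two_row n m) (two_row n l)"
    \<comment> \<open>Setting the first variable of each alphabet to 1 dehomogenises both sides into
      polynomials in \<open>s\<close> and \<open>t\<close>.\<close>
    have poly: "(\<Sum>a\<le>n. \<Sum>b\<le>n. F (int a) (int b) * s ^ a * t ^ b) =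
        (\<Sum>a\<le>n. \<Sum>b\<le>n. (\<Sum>m\<le>min a (n - a). \<Sum>l\<le>min b (n - b). ?c m l) * s ^ a * t ^ b)" for s t
      using c[unfolded expands_def lhs rhs, THEN spec, THEN spec, of "\<lambda>k. if k = 0 then 1 else s" "\<lambda>k. if k = 0 then 1 else t"]
      by (simp add: monomial_def)
    have E: "(\<Sum>m\<le>a. \<Sum>l\<le>b. ?c m l) = (\<Sum>m\<le>a. \<Sum>l\<le>b. D m l)" if "a \<le> n div 2" "b \<le> n div 2" for a b
    proof -
      have "min a (n - a) = a" "min b (n - b) = b" "a \<le> n" "b \<le> n" using that by auto
      then show ?thesis using bivariate_polyfun_eq_coeffs[OF poly, of a b] prefix by simp
    qed
    have "(\<Sum>l\<le>b. ?c a l) = (\<Sum>l\<le>b. D a l)" if "a \<le> n div 2" "b \<le> n div 2" for a b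
      by (rule eq_of_prefix_sums_eq[of "n div 2" "\<lambda>m. \<Sum>l\<le>b. ?c m l"]) (use E that in auto)
    then have "?c a b = D a b" if "a \<le> n div 2" "b \<le> n div 2" for a b
      by (rule eq_of_prefix_sums_eq[of "n div 2" "?c a"]) (use that in auto)
    then have "c m l = D (part m 2) (part l 2)" if "m \<in> partitions_upto n 2" "l \<in> partitions_upto n 2" for m l
      using two_row_part[OF that(1)] two_row_part[OF that(2)] by metis
    with c0 show "c = C" by (auto simp: C_def fun_eq_iff)
  qed
  have "(THE c. expands c \<and> (\<forall>m l. m \<notin> partitions_upto n 2 \<or> l \<notin> partitions_upto n 2 \<longrightarrow> c m l = 0)) = C"
    by (rule the_equality, rule conjI[OF C], simp add: C_def, erule conjE, rule unique)
  then have "kron mu nu la = C mu nu"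
    unfolding kron_def expands_def n_def by simp
  then show ?thesis using mu nu by (simp add: C_def D_def i_def j_def)
qed

theorem theorem3p5:
  fixes la mu nu :: "nat list"
  assumes "is_partition la" and "is_partition mu" and "is_partition nu"
    and "sum_list mu = sum_list la" and "sum_list nu = sum_list la"
    and "length la \<le> 4" and "length mu \<le> 2" and "length nu \<le> 2"
    and "part mu 2 \<ge> part nu 2"
  shows "real (atomic_kron mu nu la) \<ge> kron mu nu la"
proof -
  interpret four_parts "int (row_length la 0)" "int (row_length la 1)" "int (row_length la 2)" "int (row_length la 3)"
    by (rule four_parts_row_length[OF assms(1)])
  let ?i = "int (part mu 2)" and ?j = "int (part nu 2)"
  have mu: "mu \<in> partitions_upto (sum_list la) 2" and nu: "nu \<in> partitions_upto (sum_list la) 2"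
    using assms by (auto simp: partitions_upto_def)
  have parts: "part la 2 = row_length la 1" "part la 3 = row_length la 2" "part la 4 = row_length la 3"
    using part_eq_row_length[of la 1] part_eq_row_length[of la 2] part_eq_row_length[of la 3]
    by (simp_all add: eval_nat_numeral)
  have "total = int (sum_list la)"
    using sum_row_length[OF assms(6)] unfolding total_def by linarith
  \<comment> \<open>The second part of a two-row partition is at most half its size, the range in
    which Clebsch-Gordan applies.\<close>
  then have "2 * ?i \<le> total"
    using two_row_part(2)[OF mu] by simp
  from weight_count_second_diff_le[OF this, of ?j]
  have "int (weight_count ?i ?j) - int (weight_count (?i - 1) ?j) - int (weight_count ?i (?j - 1))
      + int (weight_count (?i - 1) (?j - 1)) \<le> int (atomic_kron mu nu la)"
    unfolding atomic_kron_def parts .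
  then show ?thesis
    unfolding kron_eq_second_diff[OF assms(1,6) mu nu] by linarith
qed

end
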